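(* Let $\mathbb{F}$ be a field and $n\ge0$. The algebra $\mathcal{H}_n$ decomposes into a direct sum of $F_{n+1}$ many one-dimensional simple submodules $\mathbf{C}_\alpha$ indexed by $\alpha\propto n$, with the $\mathcal{H}_n$-action on $\mathbf{C}_\alpha$ given by $x_i=1$ if $i\in D(\alpha)$ and $x_i=0$ otherwise.
   Context: $\mathcal{H}_0:=\mathbb{F}$ and, for $n\ge1$, $\mathcal{H}_n$ is the commutative $\mathbb{F}$-algebra generated by $x_1,\ldots,x_{n-1}$ with relations $x_i^2=x_i$ for $1\le i\le n-1$ and $x_ix_{i+1}=0$ for $1\le i\le n-2$ (that is, the quotient of $\mathbb{F}[x_1,\ldots,x_{n-1}]$ by the ideal generated by these relations). A composition of $n$ is a sequence $\alpha=(\alpha_1,\ldots,\alpha_\ell)$ of positive integers with sum $n$ (the empty composition for $n=0$); its descent set is $D(\alpha):=\{\alpha_1,\alpha_1+\alpha_2,\ldots,\alpha_1+\cdots+\alpha_{\ell-1}\}$. Write $\alpha\propto n$ if $\alpha$ is a composition of $n$ with all internal parts larger than $1$, i.e. $\alpha_i>1$ whenever $1<i<\ell$. Fibonacci numbers: $F_0=0$, $F_1=1$, $F_n=F_{n-1}+F_{n-2}$ for $n\ge2$. *)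

theory Defs
  imports
    "HOL-Algebra.Algebraic_Closure_Type"
    "HOL-Algebra.Embedded_Algebras"
    "HOL-Algebra.QuotRing"
    "HOL-Algebra.Module"
    "HOL-Library.Poly_Mapping"
    "HOL-Number_Theory.Fib"
begin

section \<open>The algebra H n\<close>

type_synonym 'a mvpoly = "(nat \<Rightarrow>\<^sub>0 nat) \<Rightarrow>\<^sub>0 'a"

definition mvpoly_const :: "'a::field \<Rightarrow> 'a mvpoly" where
  "mvpoly_const c = Poly_Mapping.single 0 c"

definition mvpoly_var :: "nat \<Rightarrow> 'a::field mvpoly" where
  "mvpoly_var i = Poly_Mapping.single (Poly_Mapping.single i 1) 1"

definition mvpoly_ring :: "nat \<Rightarrow> 'a::field mvpoly ring" where
  "mvpoly_ring n = ring_of_type_algebra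
     \<lparr>carrier := {p. \<forall>m \<in> Poly_Mapping.keys p. Poly_Mapping.keys m \<subseteq> {1..<n}}\<rparr>"

definition H_relations :: "nat \<Rightarrow> 'a::field mvpoly set" where
  "H_relations n =
     {mvpoly_var i ^ 2 - mvpoly_var i | i. 1 \<le> i \<and> i < n} \<union>
     {mvpoly_var i * mvpoly_var (i + 1) | i. 1 \<le> i \<and> i + 1 < n}"

definition H_ideal :: "nat \<Rightarrow> 'a::field mvpoly set" where
  "H_ideal n = Idl\<^bsub>mvpoly_ring n\<^esub> (H_relations n)"

text \<open>For \<open>n \<le> 1\<close> there are neither generators nor relations, so \<open>H_alg n\<close> is the
  ground field (up to the canonical isomorphism); this includes the convention for \<open>n = 0\<close>.\<close>

definition H_alg :: "nat \<Rightarrow> 'a::field mvpoly set ring" where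
  "H_alg n = mvpoly_ring n Quot H_ideal n"

definition H_gen :: "nat \<Rightarrow> nat \<Rightarrow> 'a::field mvpoly set" where
  "H_gen n i = H_ideal n +>\<^bsub>mvpoly_ring n\<^esub> mvpoly_var i"

text \<open>The image of the ground field in \<open>H_alg n\<close>; dimensions over the ground field are
  dimensions over this subfield in the sense of \<^theory>\<open>HOL-Algebra.Embedded_Algebras\<close>
  (see \<open>H_embedded_algebra\<close> below).\<close>

definition H_scalars :: "nat \<Rightarrow> 'a::field mvpoly set set" where
  "H_scalars n = range (\<lambda>c. H_ideal n +>\<^bsub>mvpoly_ring n\<^esub> mvpoly_const c)"

lemma carrier_mvpoly_ring:
  "p \<in> carrier (mvpoly_ring n) \<longleftrightarrow> (\<forall>m \<in> Poly_Mapping.keys p. Poly_Mapping.keys m \<subseteq> {1..<n})"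
  by (simp add: mvpoly_ring_def)

lemma mvpoly_ring_ops [simp]:
  "x \<otimes>\<^bsub>mvpoly_ring n\<^esub> y = x * y" "x \<oplus>\<^bsub>mvpoly_ring n\<^esub> y = x + y"
  "\<one>\<^bsub>mvpoly_ring n\<^esub> = 1" "\<zero>\<^bsub>mvpoly_ring n\<^esub> = 0"
  by (simp_all add: mvpoly_ring_def ring_of_type_algebra_def)

lemma mvpoly_ring_closed:
  assumes "x \<in> carrier (mvpoly_ring n)" "y \<in> carrier (mvpoly_ring n)"
  shows "x + y \<in> carrier (mvpoly_ring n)" "x * y \<in> carrier (mvpoly_ring n)"
    "- x \<in> carrier (mvpoly_ring n)" "x - y \<in> carrier (mvpoly_ring n)"
proof -
  show "x + y \<in> carrier (mvpoly_ring n)"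
    using assms Poly_Mapping.keys_add[of x y] unfolding carrier_mvpoly_ring by blast
  show "- x \<in> carrier (mvpoly_ring n)"
    using assms unfolding carrier_mvpoly_ring by simp
  show "x - y \<in> carrier (mvpoly_ring n)"
    using assms keys_diff[of x y] unfolding carrier_mvpoly_ring by blast
  show "x * y \<in> carrier (mvpoly_ring n)"
    unfolding carrier_mvpoly_ring
  proof
    fix m assume "m \<in> Poly_Mapping.keys (x * y)"
    then obtain a b where "m = a + b" "a \<in> Poly_Mapping.keys x" "b \<in> Poly_Mapping.keys y"
      using keys_mult[of x y] by blast
    then show "Poly_Mapping.keys m \<subseteq> {1..<n}"
      using assms Poly_Mapping.keys_add[of a b] unfolding carrier_mvpoly_ring by blast
  qed
qed

lemma mvpoly_const_closed: "mvpoly_const c \<in> carrier (mvpoly_ring n)"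
  by (simp add: carrier_mvpoly_ring mvpoly_const_def)

lemma mvpoly_var_closed: "1 \<le> i \<Longrightarrow> i < n \<Longrightarrow> mvpoly_var i \<in> carrier (mvpoly_ring n)"
  by (simp add: carrier_mvpoly_ring mvpoly_var_def)

lemma mvpoly_ring_cring: "cring (mvpoly_ring n :: 'a::field mvpoly ring)"
proof (rule cringI)
  let ?R = "mvpoly_ring n :: 'a mvpoly ring"
  show "abelian_group ?R"
  proof (rule abelian_groupI)
    fix x :: "'a mvpoly" assume "x \<in> carrier ?R"
    then show "\<exists>y\<in>carrier ?R. y \<oplus>\<^bsub>?R\<^esub> x = \<zero>\<^bsub>?R\<^esub>"
      by (intro bexI[of _ "- x"]) (auto intro: mvpoly_ring_closed)
  qed (auto simp: mvpoly_ring_closed algebra_simps, simp add: carrier_mvpoly_ring)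
  show "comm_monoid ?R"
    by (rule comm_monoidI)
      (use mvpoly_const_closed[of 1] in
        \<open>auto simp: mvpoly_ring_closed algebra_simps mvpoly_const_def\<close>)
qed (simp add: algebra_simps)

lemma H_relations_closed:
  "(H_relations n :: 'a::field mvpoly set) \<subseteq> carrier (mvpoly_ring n)"
proof
  fix p :: "'a mvpoly" assume "p \<in> H_relations n"
  then consider i where "1 \<le> i" "i < n" "p = mvpoly_var i * mvpoly_var i - mvpoly_var i"
    | i where "1 \<le> i" "i + 1 < n" "p = mvpoly_var i * mvpoly_var (i + 1)"
    unfolding H_relations_def power2_eq_square by blast
  then show "p \<in> carrier (mvpoly_ring n)"
    by cases (auto intro!: mvpoly_ring_closed mvpoly_var_closed)
qed

lemma H_ideal_ideal: "ideal (H_ideal n) (mvpoly_ring n)"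
  unfolding H_ideal_def
  using ring.genideal_ideal[OF cring.axioms(1)[OF mvpoly_ring_cring] H_relations_closed] .

lemma H_cring: "cring (H_alg n)"
  unfolding H_alg_def by (rule ideal.quotient_is_cring[OF H_ideal_ideal mvpoly_ring_cring])

lemma one_notin_H_ideal: "1 \<notin> (H_ideal n :: 'a::field mvpoly set)"
proof -
  let ?R = "mvpoly_ring n :: 'a mvpoly ring"
  define J where "J = {p \<in> carrier ?R. Poly_Mapping.lookup p 0 = 0}"
  interpret R: cring ?R by (rule mvpoly_ring_cring)
  have sum0: "b = 0" if "a + b = 0" for a b :: "nat \<Rightarrow>\<^sub>0 nat"
    using that by (metis add_is_0 lookup_add lookup_zero poly_mapping_eqI)
  have mult0: "Poly_Mapping.lookup (p * q) 0 = 0" if "Poly_Mapping.lookup q 0 = 0"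
    for p q :: "'a mvpoly"
  proof (rule ccontr)
    assume "Poly_Mapping.lookup (p * q) 0 \<noteq> 0"
    then have "0 \<in> Poly_Mapping.keys (p * q)" by (simp add: in_keys_iff)
    then obtain a b where "0 = a + b" "b \<in> Poly_Mapping.keys q"
      using keys_mult[of p q] by blast
    with sum0[of a b] that show False by (simp add: in_keys_iff)
  qed
  have neg: "\<ominus>\<^bsub>?R\<^esub> x = - x" if "x \<in> carrier ?R" for x
    using that by (intro R.minus_equality) (auto simp: mvpoly_ring_closed)
  have "ideal J ?R"
  proof (rule idealI)
    show "ring ?R" by (rule R.ring_axioms)
    have "0 \<in> J" by (simp add: J_def carrier_mvpoly_ring)
    show "subgroup J (add_monoid ?R)"
    proof (rule R.add.subgroupI)
      fix a assume "a \<in> J"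
      then show "\<ominus>\<^bsub>?R\<^esub> a \<in> J"
        by (subst neg) (auto simp: J_def mvpoly_ring_closed)
    qed (use \<open>0 \<in> J\<close> in \<open>auto simp: J_def mvpoly_ring_closed lookup_add\<close>)
    fix a x assume "a \<in> J" "x \<in> carrier ?R"
    then show "x \<otimes>\<^bsub>?R\<^esub> a \<in> J" "a \<otimes>\<^bsub>?R\<^esub> x \<in> J"
      using mult0[of a x] by (auto simp: J_def mvpoly_ring_closed mult.commute)
  qed
  moreover have "H_relations n \<subseteq> J"
  proof
    fix p :: "'a mvpoly" assume p: "p \<in> H_relations n"
    have var0: "Poly_Mapping.lookup (mvpoly_var i :: 'a mvpoly) 0 = 0" for i
    proof -
      have "Poly_Mapping.single i 1 \<noteq> (0 :: nat \<Rightarrow>\<^sub>0 nat)"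
        by (metis lookup_single_eq lookup_zero one_neq_zero)
      then show ?thesis by (simp add: mvpoly_var_def lookup_single when_def)
    qed
    from p show "p \<in> J"
      using H_relations_closed[of n] mult0[OF var0]
      by (auto simp: J_def H_relations_def power2_eq_square lookup_minus var0)
  qed
  ultimately have "H_ideal n \<subseteq> J"
    unfolding H_ideal_def by (rule R.genideal_minimal)
  then show ?thesis by (auto simp: J_def)
qed

lemma H_embedded_algebra: "embedded_algebra (H_scalars n :: 'a::field mvpoly set set) (H_alg n)"
proof -
  let ?F = "ring_of_type_algebra :: 'a ring"
  let ?h = "\<lambda>c. H_ideal n +>\<^bsub>mvpoly_ring n\<^esub> mvpoly_const c"
  interpret I: ideal "H_ideal n" "mvpoly_ring n :: 'a mvpoly ring" by (rule H_ideal_ideal)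
  interpret H: cring "H_alg n :: 'a mvpoly set ring" by (rule H_cring)
  interpret F: field ?F by (rule field_from_type_algebra)
  have "mvpoly_const \<in> ring_hom ?F (mvpoly_ring n)"
    by (rule ring_hom_memI)
      (simp_all add: mvpoly_const_closed ring_of_type_algebra_def,
       simp_all add: mvpoly_const_def mult_single single_add)
  then have "?h \<in> ring_hom ?F (H_alg n)"
    using ring_hom_trans[OF _ I.rcos_ring_hom] by (simp add: H_alg_def comp_def)
  then interpret h: ring_hom_ring ?F "H_alg n" ?h
    by (intro ring_hom_ringI2) (auto intro: F.ring_axioms H.ring_axioms)
  have "\<one>\<^bsub>H_alg n\<^esub> \<noteq> (\<zero>\<^bsub>H_alg n\<^esub> :: 'a mvpoly set)"
    using one_notin_H_ideal[of n] I.a_rcos_self[of 1] mvpoly_const_closed[of 1 n]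
    by (auto simp: H_alg_def FactRing_def mvpoly_const_def)
  then have "subfield (?h ` carrier ?F) (H_alg n)"
    using h.img_is_subfield(2)[OF F.carrier_is_subfield] by simp
  then show ?thesis
    by (simp add: H_scalars_def embedded_algebra_def H.ring_axioms ring_of_type_algebra_def)
qed


section \<open>Modules\<close>

definition regular_module :: "('b, 'm) ring_scheme \<Rightarrow> ('b, 'b) module" where
  "regular_module R =
     \<lparr>carrier = carrier R, monoid.mult = monoid.mult R, one = one R, zero = zero R,
      add = add R, module.smult = monoid.mult R\<rparr>"

definition simple_module :: "('r, 'm) ring_scheme \<Rightarrow> ('r, 'b, 'k) module_scheme \<Rightarrow> bool" where
  "simple_module R M \<longleftrightarrow>
     module R M \<and> carrier M \<noteq> {\<zero>\<^bsub>M\<^esub>} \<and>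
     (\<forall>N. submodule N R M \<longrightarrow> N = {\<zero>\<^bsub>M\<^esub>} \<or> N = carrier M)"

definition internal_direct_sum ::
  "('r, 'm) ring_scheme \<Rightarrow> ('r, 'b, 'k) module_scheme \<Rightarrow> 'i set \<Rightarrow> ('i \<Rightarrow> 'b set) \<Rightarrow> bool" where
  "internal_direct_sum R M A C \<longleftrightarrow>
     finite A \<and> (\<forall>a \<in> A. submodule (C a) R M) \<and>
     bij_betw (\<lambda>v. \<Oplus>\<^bsub>M\<^esub>a\<in>A. v a) (\<Pi>\<^sub>E a\<in>A. C a) (carrier M)"


section \<open>Compositions\<close>

definition is_composition :: "nat list \<Rightarrow> nat \<Rightarrow> bool" where
  "is_composition \<alpha> n \<longleftrightarrow> (\<forall>a \<in> set \<alpha>. 0 < a) \<and> sum_list \<alpha> = n"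

definition descent_set :: "nat list \<Rightarrow> nat set" where
  "descent_set \<alpha> = {sum_list (take k \<alpha>) | k. 1 \<le> k \<and> k < length \<alpha>}"

text \<open>The parts of \<open>\<alpha>\<close> are indexed from 0, so the internal ones are those at positions
  \<open>0 < i < length \<alpha> - 1\<close>.\<close>

definition internal_gt1 :: "nat list \<Rightarrow> nat \<Rightarrow> bool" (infix \<open>\<propto>\<close> 50) where
  "\<alpha> \<propto> n \<longleftrightarrow> is_composition \<alpha> n \<and> (\<forall>i. 0 < i \<and> i + 1 < length \<alpha> \<longrightarrow> 1 < \<alpha> ! i)"

end

theory Submission
  imports Defs
begin

text \<open>For \<open>S \<subseteq> {1..<n}\<close> put \<open>e\<^sub>S = (\<Prod>i\<in>S. x\<^sub>i) * (\<Prod>i\<notin>S. 1 - x\<^sub>i)\<close>. Expanding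
  \<open>1 = (\<Prod>i. x\<^sub>i + (1 - x\<^sub>i))\<close> gives \<open>1 = (\<Sum>S. e\<^sub>S)\<close>, and the relations \<open>x\<^sub>i\<^sup>2 = x\<^sub>i\<close> yield
  \<open>p * e\<^sub>S = p(S) * e\<^sub>S\<close>, where \<open>p(S)\<close> is the value of \<open>p\<close> at the indicator vector of \<open>S\<close>. If \<open>S\<close>
  contains two consecutive numbers, then \<open>e\<^sub>S = 0\<close> by \<open>x\<^sub>i * x\<^sub>i\<^sub>+\<^sub>1 = 0\<close>; otherwise
  evaluation at \<open>S\<close> respects all relations and sends \<open>e\<^sub>S\<close> to \<open>1\<close>, so \<open>e\<^sub>S\<close> spans a line.
  Descent sets identify the compositions \<open>\<alpha> \<propto> n\<close> with the sets \<open>S\<close> of the second kind.\<close>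

section \<open>Compositions and sets without consecutive elements\<close>

definition sparse_sets :: "nat \<Rightarrow> nat set set" where
  "sparse_sets n = {S. S \<subseteq> {1..<n} \<and> (\<forall>i\<in>S. Suc i \<notin> S)}"

lemma finite_sparse_sets [simp]: "finite (sparse_sets n)"
  by (rule finite_subset[of _ "Pow {1..<n}"]) (auto simp: sparse_sets_def)

text \<open>Fibonacci recursion by cases on the largest admissible element \<open>Suc n\<close>: a
  sparse set containing it avoids \<open>n\<close>, so deleting it leaves a member of
  \<open>sparse_sets n\<close>; a sparse set avoiding it already lies in
  \<open>sparse_sets (Suc n)\<close>.\<close>

lemma card_sparse_sets: "card (sparse_sets n) = fib (n + 1)"
proof (induction n rule: fib.induct)
  case 1
  have "sparse_sets 0 = {{}}" by (auto simp: sparse_sets_def)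
  then show ?case by simp
next
  case 2
  have "sparse_sets (Suc 0) = {{}}" by (auto simp: sparse_sets_def)
  then show ?case by simp
next
  case (3 n)
  have in_iff: "S \<in> sparse_sets (Suc n) \<longleftrightarrow> S \<in> sparse_sets (Suc (Suc n)) \<and> Suc n \<notin> S" for S
    unfolding sparse_sets_def using less_antisym by fastforce
  have split: "sparse_sets (Suc (Suc n)) =
      sparse_sets (Suc n) \<union> insert (Suc n) ` sparse_sets n" (is "?L = ?R")
  proof
    show "?L \<subseteq> ?R"
    proof
      fix S assume S: "S \<in> ?L"
      show "S \<in> ?R"
      proof (cases "Suc n \<in> S")
        case True
        have "n \<notin> S" using S True by (auto simp: sparse_sets_def)
        have "i < n" if "i \<in> S - {Suc n}" for i
        proof -
          have "i \<noteq> n" "i \<noteq> Suc n" "i < Suc (Suc n)"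
            using that \<open>n \<notin> S\<close> S by (auto simp: sparse_sets_def)
          then show ?thesis by simp
        qed
        then have "S - {Suc n} \<in> sparse_sets n"
          using S by (simp add: sparse_sets_def subset_iff)
        moreover have "S = insert (Suc n) (S - {Suc n})" using True by auto
        ultimately show ?thesis by blast
      qed (use S in_iff in blast)
    qed
    show "?R \<subseteq> ?L"
      using in_iff by (fastforce simp: sparse_sets_def)
  qed
  have "inj_on (insert (Suc n)) (sparse_sets n)"
  proof (rule inj_onI)
    fix S T assume "S \<in> sparse_sets n" "T \<in> sparse_sets n" "insert (Suc n) S = insert (Suc n) T"
    moreover from this have "Suc n \<notin> S" "Suc n \<notin> T" by (auto simp: sparse_sets_def)
    ultimately show "S = T" by (metis insert_ident)
  qed
  then have "card (insert (Suc n) ` sparse_sets n) = fib (n + 1)"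
    using 3 by (simp add: card_image)
  moreover have "sparse_sets (Suc n) \<inter> insert (Suc n) ` sparse_sets n = {}"
    using in_iff by auto
  ultimately show ?case
    unfolding split using 3 by (subst card_Un_disjoint) auto
qed

section \<open>Descent sets as a bijection from compositions to sets\<close>

lemma descent_set_Nil [simp]: "descent_set [] = {}"
  by (simp add: descent_set_def)

lemma descent_set_singleton [simp]: "descent_set [a] = {}"
  by (auto simp: descent_set_def)

text \<open>Basis of all inductions on compositions below. Two leading parts are displayed because
  the first partial sum counts as a descent only if another part follows.\<close>

lemma descent_set_Cons:
  "descent_set (a # b # l) = insert a ((+) a ` descent_set (b # l))" (is "?L = ?R")
proof
  show "?L \<subseteq> ?R"
  proof
    fix x assume "x \<in> ?L"
    then obtain k where k: "1 \<le> k" "k < length (a # b # l)" "x = sum_list (take k (a # b # l))"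
      by (auto simp: descent_set_def)
    then obtain j where j: "k = Suc j" by (cases k) auto
    show "x \<in> ?R"
    proof (cases "j = 0")
      case False
      then have "sum_list (take j (b # l)) \<in> descent_set (b # l)"
        using k j unfolding descent_set_def by (intro CollectI exI[of _ j]) auto
      then show ?thesis using k j by auto
    qed (use k j in auto)
  qed
  show "?R \<subseteq> ?L"
  proof
    fix x assume "x \<in> ?R"
    then consider "x = a" | k where "1 \<le> k" "k < length (b # l)"
        "x = a + sum_list (take k (b # l))"
      by (auto simp: descent_set_def)
    then show "x \<in> ?L"
    proof cases
      case 1
      then show ?thesis unfolding descent_set_def by (intro CollectI exI[of _ 1]) auto
    next
      case 2
      then show ?thesis unfolding descent_set_def by (intro CollectI exI[of _ "Suc k"]) auto
    qed
  qed
qed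

lemma is_composition_Cons:
  "is_composition (a # l) n \<longleftrightarrow> 0 < a \<and> a \<le> n \<and> is_composition l (n - a)"
  by (auto simp: is_composition_def)

lemma descent_set_subset: "is_composition \<alpha> n \<Longrightarrow> descent_set \<alpha> \<subseteq> {1..<n}"
proof (induction \<alpha> arbitrary: n rule: induct_list012)
  case (3 a b l)
  have "descent_set (b # l) \<subseteq> {1..<n - a}"
    using 3 by (simp add: is_composition_Cons)
  moreover have "0 < a" "a < n" using 3(3) by (auto simp: is_composition_def)
  ultimately show ?case by (fastforce simp: descent_set_Cons)
qed auto

text \<open>The first part can be read off from the descent set, and it can be stripped off without
  losing a descent of the tail: those are positive, so after the shift they exceed
  \<open>a\<close>.\<close>

lemma Min_descent_set:
  assumes "is_composition (a # b # l) n"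
  shows "Min (descent_set (a # b # l)) = a" "a \<notin> (+) a ` descent_set (b # l)"
proof -
  have "descent_set (b # l) \<subseteq> {1..<n - a}"
    using assms descent_set_subset is_composition_Cons by blast
  then have "finite (descent_set (b # l))" "0 \<notin> descent_set (b # l)"
    by (auto intro: finite_subset)
  then show "Min (descent_set (a # b # l)) = a" "a \<notin> (+) a ` descent_set (b # l)"
    by (auto simp: descent_set_Cons intro: Min_eqI)
qed

text \<open>If there are descents, their minimum is the first part of both lists; removing it and
  shifting back reduces to the tails. Without descents there is at most one part, and
  \<open>n\<close> determines it.\<close>

lemma descent_set_inj:
  assumes "is_composition \<alpha> n" "is_composition \<beta> n" "descent_set \<alpha> = descent_set \<beta>"
  shows "\<alpha> = \<beta>"
  using assms
proof (induction \<alpha> arbitrary: \<beta> n rule: induct_list012)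
  case 1
  then show ?case by (cases \<beta>) (auto simp: is_composition_def)
next
  case (2 a)
  then obtain b m where \<beta>: "\<beta> = b # m" by (cases \<beta>) (auto simp: is_composition_def)
  with 2 show ?case by (cases m) (auto simp: is_composition_def descent_set_Cons)
next
  case (3 a b l)
  then have "descent_set \<beta> \<noteq> {}" by (auto simp: descent_set_Cons)
  then obtain c d m where \<beta>: "\<beta> = c # d # m"
    using remdups_adj.cases[of \<beta>] by (metis descent_set_Nil descent_set_singleton)
  have c: "c = a" using 3 Min_descent_set(1) \<beta> by metis
  have "(+) a ` descent_set (b # l) = (+) a ` descent_set (d # m)"
    using 3(5) Min_descent_set(2)[OF 3(3)] Min_descent_set(2)[OF 3(4)[unfolded \<beta>]]
    unfolding \<beta> c descent_set_Cons by (metis insert_ident)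
  then have "descent_set (b # l) = descent_set (d # m)"
    by (simp add: inj_image_eq_iff)
  moreover have "is_composition (b # l) (n - a)" "is_composition (d # m) (n - a)"
    using 3 by (simp_all add: \<beta> c is_composition_Cons)
  ultimately show ?case using 3(2) \<beta> c by blast
qed

text \<open>Recursive construction: \<open>Min S\<close> becomes the first part, and the remaining
  elements, shifted down by it, are the descents of a composition of
  \<open>n - Min S\<close>.\<close>

lemma descent_set_surj:
  assumes "S \<subseteq> {1..<n}"
  shows "\<exists>\<alpha>. is_composition \<alpha> n \<and> descent_set \<alpha> = S"
  using assms
proof (induction n arbitrary: S rule: less_induct)
  case (less n)
  show ?case
  proof (cases "S = {}")
    case True
    \<comment> \<open>Parts are positive, so for \<open>n = 0\<close> the composition without
      descents is \<open>[]\<close> and not \<open>[0]\<close>.\<close>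
    then show ?thesis
      by (intro exI[of _ "if n = 0 then [] else [n]"]) (auto simp: is_composition_def)
  next
    case False
    have fin: "finite S" using less.prems finite_subset by blast
    define a where "a = Min S"
    have a: "a \<in> S" "\<And>x. x \<in> S \<Longrightarrow> a \<le> x" using fin False by (auto simp: a_def)
    then have an: "1 \<le> a" "a < n" using less.prems by auto
    have "(\<lambda>x. x - a) ` (S - {a}) \<subseteq> {1..<n - a}"
    proof
      fix y assume "y \<in> (\<lambda>x. x - a) ` (S - {a})"
      then obtain x where "y = x - a" "x \<in> S" "x \<noteq> a" by auto
      with a(2)[of x] less.prems show "y \<in> {1..<n - a}" by fastforce
    qed
    with less.IH[OF _ this] an obtain l where
      l: "is_composition l (n - a)" "descent_set l = (\<lambda>x. x - a) ` (S - {a})"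
      by force
    then obtain b m where bm: "l = b # m" using an by (cases l) (auto simp: is_composition_def)
    \<comment> \<open>Truncated subtraction is undone by adding \<open>a\<close> because
      \<open>a\<close> is the minimum of \<open>S\<close>.\<close>
    have "(+) a ` (\<lambda>x. x - a) ` (S - {a}) = S - {a}"
      using a(2) by (force simp: image_image)
    then have "descent_set (a # l) = S" using l a(1) by (auto simp: bm descent_set_Cons)
    then show ?thesis using l an by (intro exI[of _ "a # l"]) (simp add: is_composition_Cons)
  qed
qed

text \<open>Prepending \<open>a\<close> makes the former first part \<open>b\<close> internal
  exactly when \<open>b\<close> is not the last part; the status of all later parts is
  unchanged.\<close>

lemma internal_Cons:
  "(\<forall>i. 0 < i \<and> i + 1 < length (a # b # l) \<longrightarrow> 1 < (a # b # l) ! i) \<longleftrightarrow>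
   (l \<noteq> [] \<longrightarrow> 1 < b) \<and> (\<forall>i. 0 < i \<and> i + 1 < length (b # l) \<longrightarrow> 1 < (b # l) ! i)"
  (is "?L \<longleftrightarrow> ?R")
proof
  assume L: "?L"
  then have "l \<noteq> [] \<longrightarrow> 1 < b" by (auto dest: spec[of _ 1])
  moreover have "1 < (b # l) ! i" if "0 < i" "i + 1 < length (b # l)" for i
    using that L[rule_format, of "Suc i"] by simp
  ultimately show ?R by blast
next
  assume R: ?R
  show ?L
  proof (intro allI impI)
    fix i assume i: "0 < i \<and> i + 1 < length (a # b # l)"
    then obtain j where j: "i = Suc j" by (cases i) auto
    show "1 < (a # b # l) ! i"
    proof (cases "j = 0")
      case True
      then show ?thesis using R i j by auto
    next
      case False
      then have "1 < (b # l) ! j" using i j R by auto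
      then show ?thesis using j by simp
    qed
  qed
qed

text \<open>Two consecutive descents enclose a part equal to 1, which is internal because it lies
  between two partial sums. In the induction the only new pair to examine is \<open>a\<close> and
  \<open>Suc a\<close>, that is, whether 1 is a descent of the tail.\<close>

lemma internal_iff_sparse:
  assumes "is_composition \<alpha> n"
  shows "(\<forall>i. 0 < i \<and> i + 1 < length \<alpha> \<longrightarrow> 1 < \<alpha> ! i) \<longleftrightarrow>
    (\<forall>i\<in>descent_set \<alpha>. Suc i \<notin> descent_set \<alpha>)"
  using assms
proof (induction \<alpha> arbitrary: n rule: induct_list012)
  case (3 a b l)
  have comp: "is_composition (b # l) (n - a)" using 3 by (simp add: is_composition_Cons)
  have one_mem: "Suc 0 \<in> descent_set (b # l) \<longleftrightarrow> l \<noteq> [] \<and> b = 1"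
  proof (cases l)
    case (Cons c m)
    \<comment> \<open>Every shifted descent is thus at least 2, so 1 can only arise as the first
      part \<open>b\<close> itself.\<close>
    have "0 \<notin> descent_set (c # m)" "0 < b"
      using comp descent_set_subset[of "c # m" "n - a - b"]
      by (fastforce simp: Cons is_composition_Cons)+
    then show ?thesis unfolding Cons descent_set_Cons by (auto simp: image_iff)
  qed simp
  have "0 < b" using comp by (simp add: is_composition_Cons)
  have "(\<forall>i\<in>descent_set (a # b # l). Suc i \<notin> descent_set (a # b # l)) \<longleftrightarrow>
    (l \<noteq> [] \<longrightarrow> 1 < b) \<and> (\<forall>i\<in>descent_set (b # l). Suc i \<notin> descent_set (b # l))"
  proof -
    have "Suc a \<in> (+) a ` D \<longleftrightarrow> Suc 0 \<in> D" "Suc (a + i) \<in> (+) a ` D \<longleftrightarrow> Suc i \<in> D" for D i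
      by auto
    then show ?thesis
      using one_mem \<open>0 < b\<close>
      unfolding descent_set_Cons[of a] by auto
  qed
  then show ?case using 3(2)[OF comp] internal_Cons[of a b l] by blast
qed auto

lemma bij_betw_descent_set: "bij_betw descent_set {\<alpha>. \<alpha> \<propto> n} (sparse_sets n)"
proof (rule bij_betw_imageI)
  show "inj_on descent_set {\<alpha>. \<alpha> \<propto> n}"
    by (rule inj_onI) (use descent_set_inj in \<open>auto simp: internal_gt1_def\<close>)
  show "descent_set ` {\<alpha>. \<alpha> \<propto> n} = sparse_sets n"
  proof
    show "descent_set ` {\<alpha>. \<alpha> \<propto> n} \<subseteq> sparse_sets n"
    proof (rule image_subsetI)
      fix \<alpha> assume "\<alpha> \<in> {\<alpha>. \<alpha> \<propto> n}"
      then show "descent_set \<alpha> \<in> sparse_sets n"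
        using descent_set_subset[of \<alpha> n] internal_iff_sparse[of \<alpha> n]
        by (simp add: internal_gt1_def sparse_sets_def)
    qed
    show "sparse_sets n \<subseteq> descent_set ` {\<alpha>. \<alpha> \<propto> n}"
    proof
      fix S assume S: "S \<in> sparse_sets n"
      then obtain \<alpha> where "is_composition \<alpha> n" "descent_set \<alpha> = S"
        using descent_set_surj[of S n] by (auto simp: sparse_sets_def)
      with S internal_iff_sparse[of \<alpha> n] show "S \<in> descent_set ` {\<alpha>. \<alpha> \<propto> n}"
        by (auto simp: internal_gt1_def sparse_sets_def)
    qed
  qed
qed


section \<open>Idempotent polynomials\<close>

lemma poly_mapping_sum_induct [case_names zero add_single]:
  assumes "P 0"
    and "\<And>f a b. a \<notin> Poly_Mapping.keys f \<Longrightarrow> b \<noteq> 0 \<Longrightarrow> P f \<Longrightarrow> P (f + Poly_Mapping.single a b)"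
  shows "P (f :: 'a \<Rightarrow>\<^sub>0 'b::monoid_add)"
proof (induction f rule: update_induct)
  case const
  then show ?case by (rule assms)
next
  case (update f a b)
  have "Poly_Mapping.update a b f = f + Poly_Mapping.single a b"
    using update(1)
    by (intro poly_mapping_eqI)
      (auto simp: lookup_update lookup_add lookup_single when_def in_keys_iff)
  then show ?case using assms(2) update by simp
qed

lemma keys_add_single:
  assumes "a \<notin> Poly_Mapping.keys f" "b \<noteq> 0"
  shows "Poly_Mapping.keys (f + Poly_Mapping.single a b) = insert a (Poly_Mapping.keys (f :: 'a \<Rightarrow>\<^sub>0 'b::monoid_add))"
  using assms by (auto simp: in_keys_iff lookup_add lookup_single when_def split: if_splits)

lemma mvpoly_var_power:
  "mvpoly_var i ^ k = (Poly_Mapping.single (Poly_Mapping.single i k) 1 :: 'a::field mvpoly)"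
  by (induction k) (simp_all add: mvpoly_var_def mult_single flip: single_add)

lemma mvpoly_carrier_induct [consumes 1, case_names const var add mult]:
  assumes "p \<in> carrier (mvpoly_ring n :: 'a::field mvpoly ring)"
    and const: "\<And>c. P (mvpoly_const c)"
    and var: "\<And>i. 1 \<le> i \<Longrightarrow> i < n \<Longrightarrow> P (mvpoly_var i)"
    and add: "\<And>p q. \<lbrakk>p \<in> carrier (mvpoly_ring n); q \<in> carrier (mvpoly_ring n); P p; P q\<rbrakk> \<Longrightarrow> P (p + q)"
    and mult: "\<And>p q. \<lbrakk>p \<in> carrier (mvpoly_ring n); q \<in> carrier (mvpoly_ring n); P p; P q\<rbrakk> \<Longrightarrow> P (p * q)"
  shows "P p"
proof -
  \<comment> \<open>Membership in the ring is carried along because the rules \<open>add\<close> and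
    \<open>mult\<close> require it of both operands.\<close>
  let ?Q = "\<lambda>p. p \<in> carrier (mvpoly_ring n) \<and> P p"
  have Q_const: "?Q (mvpoly_const c)" for c by (simp add: const mvpoly_const_closed)
  have Q_mult: "?Q (p * q)" if "?Q p" "?Q q" for p q using that by (simp add: mult mvpoly_ring_closed)
  have power: "?Q (mvpoly_var i ^ k)" if "1 \<le> i" "i < n" for i k
    using that Q_const[of 1] by (induction k)
      (auto simp: mvpoly_const_def intro!: Q_mult var mvpoly_var_closed)
  \<comment> \<open>Induction on the exponent vector: each new entry contributes a power of one
    variable as a factor. The same principle is then applied to the polynomial, term by
    term.\<close>
  have mono: "?Q (Poly_Mapping.single m c)" if "Poly_Mapping.keys m \<subseteq> {1..<n}" for m c
    using that
  proof (induction m rule: poly_mapping_sum_induct)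
    case zero
    then show ?case using Q_const[of c] by (simp add: mvpoly_const_def)
  next
    case (add_single m i k)
    then have "?Q (Poly_Mapping.single m c * mvpoly_var i ^ k)"
      by (intro Q_mult power) (auto simp: keys_add_single)
    then show ?case by (simp add: mvpoly_var_power mult_single)
  qed
  from assms(1) have "?Q p"
  proof (induction p rule: poly_mapping_sum_induct)
    case zero
    then show ?case using Q_const[of 0] by (simp add: mvpoly_const_def)
  next
    case (add_single p m c)
    then have "?Q p" "?Q (Poly_Mapping.single m c)"
      by (intro add_single mono; simp add: carrier_mvpoly_ring keys_add_single)+
    then show ?case by (simp add: add mvpoly_ring_closed)
  qed
  then show ?thesis ..
qed

text \<open>The value of \<open>p\<close> at the indicator vector of \<open>S\<close>: at such a
  point a monomial is 1 if all its variables lie in \<open>S\<close> and 0 otherwise, whatever the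
  positive exponents are.\<close>

definition indicator_eval :: "nat set \<Rightarrow> 'a::field mvpoly \<Rightarrow> 'a" where
  "indicator_eval S p =
     (\<Sum>m\<in>Poly_Mapping.keys p. if Poly_Mapping.keys m \<subseteq> S then Poly_Mapping.lookup p m else 0)"

lemma indicator_eval_0 [simp]: "indicator_eval S 0 = 0"
  by (simp add: indicator_eval_def)

lemma indicator_eval_single [simp]:
  "indicator_eval S (Poly_Mapping.single m c) = (if Poly_Mapping.keys m \<subseteq> S then c else 0)"
  by (simp add: indicator_eval_def)

lemma indicator_eval_const [simp]: "indicator_eval S (mvpoly_const c) = c"
  by (simp add: mvpoly_const_def)

lemma indicator_eval_1 [simp]: "indicator_eval S 1 = 1"
  using indicator_eval_single[of S 0 1] by simp

lemma indicator_eval_var [simp]: "indicator_eval S (mvpoly_var i) = (if i \<in> S then 1 else 0)"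
  by (simp add: mvpoly_var_def)

lemma indicator_eval_add [simp]:
  "indicator_eval S (p + q) = indicator_eval S p + indicator_eval S q"
  unfolding indicator_eval_def by (rule setsum_keys_plus_distrib) simp_all

lemma indicator_eval_uminus [simp]: "indicator_eval S (- p) = - indicator_eval S p"
  using indicator_eval_add[of S p "- p"] by (simp add: add_eq_0_iff)

lemma indicator_eval_diff [simp]:
  "indicator_eval S (p - q) = indicator_eval S p - indicator_eval S q"
  using indicator_eval_add[of S p "- q"] by simp

lemma keys_add_nat: "Poly_Mapping.keys (m + k :: 'a \<Rightarrow>\<^sub>0 nat) = Poly_Mapping.keys m \<union> Poly_Mapping.keys k"
  by (auto simp: in_keys_iff lookup_add)

text \<open>Additivity in both factors reduces this to single terms. There it holds because natural
  exponents cannot cancel, so the variables of a product of monomials are the union of those of the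
  factors.\<close>

lemma indicator_eval_mult [simp]:
  "indicator_eval S (p * q) = indicator_eval S p * indicator_eval S q"
proof (induction p rule: poly_mapping_sum_induct)
  case (add_single p m c)
  have "indicator_eval S (Poly_Mapping.single m c * q) =
      indicator_eval S (Poly_Mapping.single m c) * indicator_eval S q"
    by (induction q rule: poly_mapping_sum_induct)
      (auto simp: mult_single keys_add_nat distrib_left)
  then show ?case using add_single by (simp only: distrib_right indicator_eval_add)
qed simp

lemma indicator_eval_prod: "indicator_eval S (prod f A) = (\<Prod>x\<in>A. indicator_eval S (f x))"
  by (induction A rule: infinite_finite_induct) auto

section \<open>The polynomials \<open>idem n S\<close> and the ideal of relations\<close>

definition idem :: "nat \<Rightarrow> nat set \<Rightarrow> 'a::field mvpoly" where
  "idem n S = (\<Prod>i\<in>S. mvpoly_var i) * (\<Prod>i\<in>{1..<n} - S. 1 - mvpoly_var i)"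

lemma one_closed: "1 \<in> carrier (mvpoly_ring n)"
  using mvpoly_const_closed[of 1 n] by (simp add: mvpoly_const_def)

lemma zero_closed: "0 \<in> carrier (mvpoly_ring n)"
  by (simp add: carrier_mvpoly_ring)

lemma prod_closed:
  "(\<And>x. x \<in> A \<Longrightarrow> f x \<in> carrier (mvpoly_ring n)) \<Longrightarrow> prod f A \<in> carrier (mvpoly_ring n)"
  by (induction A rule: infinite_finite_induct) (auto intro: one_closed mvpoly_ring_closed)

lemma sum_closed:
  "(\<And>x. x \<in> A \<Longrightarrow> f x \<in> carrier (mvpoly_ring n)) \<Longrightarrow> sum f A \<in> carrier (mvpoly_ring n)"
  by (induction A rule: infinite_finite_induct)
    (auto intro: zero_closed mvpoly_ring_closed)

lemma idem_closed: "S \<subseteq> {1..<n} \<Longrightarrow> idem n S \<in> carrier (mvpoly_ring n)"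
  unfolding idem_def
  by (intro mvpoly_ring_closed prod_closed one_closed mvpoly_var_closed) auto

text \<open>If the sets differ, an element belonging to exactly one of them makes a factor vanish at
  \<open>S\<close>: \<open>mvpoly_var i\<close> if it lies in \<open>T\<close>, and
  \<open>1 - mvpoly_var i\<close> if it lies in \<open>S\<close>.\<close>

lemma indicator_eval_idem:
  assumes "S \<subseteq> {1..<n}" "T \<subseteq> {1..<n}"
  shows "indicator_eval S (idem n T) = (if S = T then 1 else 0)"
proof (cases "S = T")
  case False
  have fin: "finite T" using assms finite_subset by blast
  from False consider i where "i \<in> T" "i \<notin> S" | i where "i \<in> S" "i \<in> {1..<n} - T"
    using assms by blast
  then show ?thesis
    using False fin by cases (auto simp: idem_def indicator_eval_prod prod_zero_iff)
qed (auto simp: idem_def indicator_eval_prod intro!: prod.neutral)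

lemma sum_idem: "(\<Sum>S\<in>Pow {1..<n}. idem n S) = 1"
  using prod_add[of "{1..<n}" mvpoly_var "\<lambda>i. 1 - mvpoly_var i"] by (simp add: idem_def)

lemma H_ideal_mult: "p \<in> H_ideal n \<Longrightarrow> q \<in> carrier (mvpoly_ring n) \<Longrightarrow> p * q \<in> H_ideal n"
  using ideal.I_r_closed[OF H_ideal_ideal] by fastforce

lemma H_ideal_add: "p \<in> H_ideal n \<Longrightarrow> q \<in> H_ideal n \<Longrightarrow> p + q \<in> H_ideal n"
  using additive_subgroup.a_closed[OF ideal.axioms(1)[OF H_ideal_ideal]] by fastforce

lemma H_ideal_zero: "0 \<in> H_ideal n"
  using additive_subgroup.zero_closed[OF ideal.axioms(1)[OF H_ideal_ideal]] by fastforce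

lemma H_ideal_uminus: "p \<in> H_ideal n \<Longrightarrow> - p \<in> H_ideal n"
  using H_ideal_mult[of p n "- 1"] one_closed mvpoly_ring_closed(3) by fastforce

lemma H_ideal_sum: "(\<And>x. x \<in> A \<Longrightarrow> f x \<in> H_ideal n) \<Longrightarrow> sum f A \<in> H_ideal n"
  by (induction A rule: infinite_finite_induct) (auto intro: H_ideal_add H_ideal_zero)

lemma H_relations_in_ideal: "H_relations n \<subseteq> H_ideal n"
  unfolding H_ideal_def
  using ring.genideal_self[OF cring.axioms(1)[OF mvpoly_ring_cring] H_relations_closed] .

lemma H_ideal_idem_rel: "1 \<le> i \<Longrightarrow> i < n \<Longrightarrow> mvpoly_var i ^ 2 - mvpoly_var i \<in> H_ideal n"
  using H_relations_in_ideal unfolding H_relations_def by blast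

lemma H_ideal_adjacent_rel: "1 \<le> i \<Longrightarrow> i + 1 < n \<Longrightarrow> mvpoly_var i * mvpoly_var (i + 1) \<in> H_ideal n"
  using H_relations_in_ideal unfolding H_relations_def by blast

text \<open>With the factor \<open>x_i\<close> split off from \<open>idem n S\<close>, the
  difference is a multiple of \<open>x_i^2 - x_i\<close>.\<close>

lemma var_mult_idem_mem:
  assumes "S \<subseteq> {1..<n}" "i \<in> S"
  shows "mvpoly_var i * idem n S - idem n S \<in> (H_ideal n :: 'a::field mvpoly set)"
proof -
  let ?r = "(\<Prod>j\<in>S - {i}. mvpoly_var j) * (\<Prod>j\<in>{1..<n} - S. 1 - mvpoly_var j) :: 'a mvpoly"
  have "(\<Prod>j\<in>S. mvpoly_var j :: 'a mvpoly) = mvpoly_var i * (\<Prod>j\<in>S - {i}. mvpoly_var j)"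
    using assms finite_subset[OF assms(1)] by (intro prod.remove) auto
  then have "idem n S = mvpoly_var i * ?r"
    by (simp only: idem_def ac_simps)
  then have "mvpoly_var i * idem n S - idem n S = (mvpoly_var i ^ 2 - mvpoly_var i) * ?r"
    by (simp add: algebra_simps power2_eq_square)
  moreover have "?r \<in> carrier (mvpoly_ring n)"
    using assms by (intro mvpoly_ring_closed prod_closed one_closed mvpoly_var_closed) auto
  moreover have "1 \<le> i" "i < n" using assms by auto
  ultimately show ?thesis
    by (simp only: H_ideal_mult[OF H_ideal_idem_rel])
qed

text \<open>Here the factor split off is \<open>1 - x_i\<close>, and \<open>x_i * (1 - x_i)\<close>
  is the negative of the relation \<open>x_i^2 - x_i\<close>.\<close>

lemma var_mult_idem_not_mem:
  assumes "S \<subseteq> {1..<n}" "i \<in> {1..<n} - S"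
  shows "mvpoly_var i * idem n S \<in> (H_ideal n :: 'a::field mvpoly set)"
proof -
  let ?r = "(\<Prod>j\<in>S. mvpoly_var j) * (\<Prod>j\<in>{1..<n} - S - {i}. 1 - mvpoly_var j) :: 'a mvpoly"
  have "(\<Prod>j\<in>{1..<n} - S. 1 - mvpoly_var j :: 'a mvpoly) =
      (1 - mvpoly_var i) * (\<Prod>j\<in>{1..<n} - S - {i}. 1 - mvpoly_var j)"
    using assms by (intro prod.remove) auto
  then have "idem n S = (1 - mvpoly_var i) * ?r"
    by (simp only: idem_def ac_simps)
  then have "mvpoly_var i * idem n S = (mvpoly_var i ^ 2 - mvpoly_var i) * (- ?r)"
    by (simp only:) (simp add: algebra_simps power2_eq_square)
  moreover have "?r \<in> carrier (mvpoly_ring n)"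
    using assms by (intro mvpoly_ring_closed(2,4) prod_closed one_closed mvpoly_var_closed) auto
  then have "- ?r \<in> carrier (mvpoly_ring n)" using mvpoly_ring_closed(3) by blast
  moreover have "1 \<le> i" "i < n" using assms by auto
  ultimately show ?thesis
    by (simp only: H_ideal_mult[OF H_ideal_idem_rel])
qed

lemma idem_not_sparse:
  assumes "S \<subseteq> {1..<n}" "S \<notin> sparse_sets n"
  shows "idem n S \<in> (H_ideal n :: 'a::field mvpoly set)"
proof -
  obtain i where i: "i \<in> S" "i + 1 \<in> S" using assms by (auto simp: sparse_sets_def)
  \<comment> \<open>The cofactor of \<open>x_i * x_{i+1}\<close> in \<open>idem n S\<close>.\<close>
  let ?r = "(\<Prod>j\<in>S - {i} - {i + 1}. mvpoly_var j) * (\<Prod>j\<in>{1..<n} - S. 1 - mvpoly_var j) :: 'a mvpoly"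
  have fin: "finite S" using finite_subset[OF assms(1)] by simp
  have "(\<Prod>j\<in>S. mvpoly_var j :: 'a mvpoly) = mvpoly_var i * (\<Prod>j\<in>S - {i}. mvpoly_var j)"
    using fin i by (intro prod.remove)
  also have "(\<Prod>j\<in>S - {i}. mvpoly_var j :: 'a mvpoly) = mvpoly_var (i + 1) * (\<Prod>j\<in>S - {i} - {i + 1}. mvpoly_var j)"
    using fin i by (intro prod.remove) auto
  finally have "idem n S = mvpoly_var i * mvpoly_var (i + 1) * ?r"
    by (simp add: idem_def mult.assoc)
  moreover have "?r \<in> carrier (mvpoly_ring n)"
    using assms by (intro mvpoly_ring_closed prod_closed one_closed mvpoly_var_closed) auto
  moreover have "1 \<le> i" "i + 1 < n" using assms i by auto
  ultimately show ?thesis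
    by (simp only: H_ideal_mult[OF H_ideal_adjacent_rel])
qed

text \<open>Modulo the ideal, \<open>idem n S\<close> is a common eigenvector with eigenvalue given
  by evaluation at \<open>S\<close>. The two lemmas on variables settle the generators, and the
  property passes to sums and products.\<close>

lemma mult_idem:
  assumes "p \<in> carrier (mvpoly_ring n)" "S \<subseteq> {1..<n}"
  shows "p * idem n S - mvpoly_const (indicator_eval S p) * idem n S \<in> H_ideal n"
  using assms(1)
proof (induction p rule: mvpoly_carrier_induct)
  case (const c)
  then show ?case by (simp add: H_ideal_zero)
next
  case (var i)
  then show ?case
    using var_mult_idem_mem[OF assms(2), of i] var_mult_idem_not_mem[OF assms(2), of i]
    by (auto simp: mvpoly_const_def)
next
  case (add p q)
  have "(p + q) * idem n S - mvpoly_const (indicator_eval S (p + q)) * idem n S =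
    (p * idem n S - mvpoly_const (indicator_eval S p) * idem n S) +
    (q * idem n S - mvpoly_const (indicator_eval S q) * idem n S)"
    by (simp add: mvpoly_const_def single_add algebra_simps)
  then show ?case using H_ideal_add[OF add(3,4)] by simp
next
  case (mult p q)
  let ?c = "\<lambda>p. mvpoly_const (indicator_eval S p)"
  \<comment> \<open>The mixed terms cancel, which leaves each induction hypothesis multiplied by a
    ring element.\<close>
  have "(p * q) * idem n S - ?c (p * q) * idem n S =
    (p * idem n S - ?c p * idem n S) * q + (q * idem n S - ?c q * idem n S) * ?c p"
  proof -
    have "?c (p * q) = ?c p * ?c q" by (simp add: mvpoly_const_def mult_single)
    then show ?thesis by (simp add: algebra_simps)
  qed
  then show ?case
    using H_ideal_add[OF H_ideal_mult[OF mult(3,2)] H_ideal_mult[OF mult(4) mvpoly_const_closed]]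
    by simp
qed

lemma mvpoly_ring_a_inv:
  assumes "p \<in> carrier (mvpoly_ring n :: 'a::field mvpoly ring)"
  shows "\<ominus>\<^bsub>mvpoly_ring n\<^esub> p = - p"
proof -
  interpret R: cring "mvpoly_ring n :: 'a mvpoly ring" by (rule mvpoly_ring_cring)
  show ?thesis
    using assms by (intro R.minus_equality) (auto simp: mvpoly_ring_closed)
qed

text \<open>The polynomials vanishing at \<open>S\<close> form an ideal, so it suffices to check the
  relations: 0 and 1 are idempotent, and sparseness forbids that \<open>x_i\<close> and
  \<open>x_{i+1}\<close> are both 1. Evaluation therefore descends to the quotient.\<close>

lemma indicator_eval_H_ideal:
  assumes "S \<in> sparse_sets n" "p \<in> (H_ideal n :: 'a::field mvpoly set)"
  shows "indicator_eval S p = 0"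
proof -
  let ?R = "mvpoly_ring n :: 'a mvpoly ring"
  define J where "J = {p \<in> carrier ?R. indicator_eval S p = 0}"
  interpret R: cring ?R by (rule mvpoly_ring_cring)
  have "ideal J ?R"
  proof (rule idealI)
    show "ring ?R" by (rule R.ring_axioms)
    have "0 \<in> J" by (simp add: J_def carrier_mvpoly_ring)
    show "subgroup J (add_monoid ?R)"
    proof (rule R.add.subgroupI)
      fix a assume "a \<in> J"
      then show "\<ominus>\<^bsub>?R\<^esub> a \<in> J"
        by (subst mvpoly_ring_a_inv) (auto simp: J_def mvpoly_ring_closed)
    qed (use \<open>0 \<in> J\<close> in \<open>auto simp: J_def mvpoly_ring_closed\<close>)
    fix a x assume "a \<in> J" "x \<in> carrier ?R"
    then show "x \<otimes>\<^bsub>?R\<^esub> a \<in> J" "a \<otimes>\<^bsub>?R\<^esub> x \<in> J"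
      by (auto simp: J_def mvpoly_ring_closed)
  qed
  moreover have "H_relations n \<subseteq> J"
    using H_relations_closed[of n] assms(1)
    by (auto simp: J_def H_relations_def power2_eq_square sparse_sets_def)
  ultimately have "H_ideal n \<subseteq> J"
    unfolding H_ideal_def by (rule R.genideal_minimal)
  then show ?thesis using assms(2) by (auto simp: J_def)
qed


section \<open>Decomposition of the quotient algebra\<close>

definition H_class :: "nat \<Rightarrow> 'a::field mvpoly \<Rightarrow> 'a mvpoly set" where
  "H_class n p = H_ideal n +>\<^bsub>mvpoly_ring n\<^esub> p"

lemma H_class_hom: "H_class n \<in> ring_hom (mvpoly_ring n) (H_alg n)"
  using ideal.rcos_ring_hom[OF H_ideal_ideal] unfolding H_class_def [abs_def] H_alg_def .

lemma H_class_closed: "p \<in> carrier (mvpoly_ring n) \<Longrightarrow> H_class n p \<in> carrier (H_alg n)"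
  by (rule ring_hom_closed[OF H_class_hom])

lemma H_class_mult:
  "\<lbrakk>p \<in> carrier (mvpoly_ring n); r \<in> carrier (mvpoly_ring n)\<rbrakk> \<Longrightarrow>
    H_class n p \<otimes>\<^bsub>H_alg n\<^esub> H_class n r = H_class n (p * r)"
  using ring_hom_mult[OF H_class_hom, of p n r] by simp

lemma H_class_add:
  "\<lbrakk>p \<in> carrier (mvpoly_ring n); r \<in> carrier (mvpoly_ring n)\<rbrakk> \<Longrightarrow>
    H_class n p \<oplus>\<^bsub>H_alg n\<^esub> H_class n r = H_class n (p + r)"
  using ring_hom_add[OF H_class_hom, of p n r] by simp

lemma H_class_1: "H_class n 1 = \<one>\<^bsub>H_alg n\<^esub>"
  using ring_hom_one[OF H_class_hom, of n] by simp

lemma H_class_0: "H_class n 0 = \<zero>\<^bsub>H_alg n\<^esub>"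
  using ring_hom_zero[OF H_class_hom cring.axioms(1) cring.axioms(1), OF mvpoly_ring_cring H_cring]
  by simp

lemma H_class_uminus:
  assumes "p \<in> carrier (mvpoly_ring n)"
  shows "\<ominus>\<^bsub>H_alg n\<^esub> H_class n p = H_class n (- p)"
proof -
  interpret H: cring "H_alg n :: 'a mvpoly set ring" by (rule H_cring)
  have "- p \<in> carrier (mvpoly_ring n)" using assms mvpoly_ring_closed(3) by blast
  then show ?thesis
    using assms by (intro H.minus_equality) (simp_all add: H_class_closed H_class_add H_class_0)
qed

lemma H_class_eq_iff:
  assumes "p \<in> carrier (mvpoly_ring n)" "r \<in> carrier (mvpoly_ring n)"
  shows "H_class n p = H_class n r \<longleftrightarrow> p - r \<in> H_ideal n"
  using ring.quotient_eq_iff_same_a_r_cos[OF cring.axioms(1)[OF mvpoly_ring_cring] H_ideal_ideal assms]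
    assms by (simp add: H_class_def a_minus_def mvpoly_ring_a_inv)

lemma carrier_H_alg: "carrier (H_alg n) = H_class n ` carrier (mvpoly_ring n)"
  by (auto simp: H_alg_def FactRing_def A_RCOSETS_def' H_class_def)

lemma H_gen_eq: "H_gen n i = H_class n (mvpoly_var i)"
  by (simp add: H_gen_def H_class_def)

lemma H_scalars_eq: "H_scalars n = range (\<lambda>c. H_class n (mvpoly_const c))"
  by (simp add: H_scalars_def H_class_def)

lemma finsum_H_class:
  fixes f :: "'b \<Rightarrow> 'a::field mvpoly"
  assumes "\<And>x. x \<in> A \<Longrightarrow> f x \<in> carrier (mvpoly_ring n)"
  shows "(\<Oplus>\<^bsub>H_alg n\<^esub>x\<in>A. H_class n (f x)) = H_class n (sum f A)"
proof -
  interpret H: cring "H_alg n :: 'a mvpoly set ring" by (rule H_cring)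
  show ?thesis
    using assms
  proof (induction A rule: infinite_finite_induct)
    case (insert x A)
    have "sum f A \<in> carrier (mvpoly_ring n)"
      using insert.prems by (intro sum_closed) auto
    with insert show ?case
      by (subst H.finsum_insert) (auto simp: H_class_closed H_class_add)
  \<comment> \<open>Over an infinite index set both sums take the default value zero.\<close>
  qed (simp_all add: H_class_0 H.add.finprod_infinite)
qed

section \<open>The lines that serve as \<open>C_\<alpha>\<close> for
  \<open>S = descent_set \<alpha>\<close>\<close>

definition idem_line :: "nat \<Rightarrow> nat set \<Rightarrow> 'a::field mvpoly set set" where
  "idem_line n S = range (\<lambda>c. H_class n (mvpoly_const c * idem n S))"

lemma const_idem_closed:
  "S \<subseteq> {1..<n} \<Longrightarrow> mvpoly_const c * idem n S \<in> carrier (mvpoly_ring n)"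
  by (intro mvpoly_ring_closed mvpoly_const_closed idem_closed)

lemma sparse_subset: "S \<in> sparse_sets n \<Longrightarrow> S \<subseteq> {1..<n}"
  by (simp add: sparse_sets_def)

lemma H_class_mult_idem:
  assumes "p \<in> carrier (mvpoly_ring n)" "S \<subseteq> {1..<n}"
  shows "H_class n p \<otimes>\<^bsub>H_alg n\<^esub> H_class n (idem n S) =
    H_class n (mvpoly_const (indicator_eval S p) * idem n S)"
  using mult_idem[OF assms] assms
  by (simp add: H_class_mult H_class_eq_iff idem_closed const_idem_closed mvpoly_ring_closed)

lemma H_class_mult_line:
  assumes "p \<in> carrier (mvpoly_ring n)" "S \<subseteq> {1..<n}"
  shows "H_class n p \<otimes>\<^bsub>H_alg n\<^esub> H_class n (mvpoly_const c * idem n S) =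
    H_class n (mvpoly_const (indicator_eval S p * c) * idem n S)"
proof -
  \<comment> \<open>The scalar is absorbed into the polynomial, whose value at \<open>S\<close> gets
    multiplied by \<open>c\<close>.\<close>
  have "H_class n p \<otimes>\<^bsub>H_alg n\<^esub> H_class n (mvpoly_const c * idem n S) =
    H_class n (p * mvpoly_const c) \<otimes>\<^bsub>H_alg n\<^esub> H_class n (idem n S)"
    using assms
    by (simp add: H_class_mult idem_closed const_idem_closed mvpoly_const_closed mvpoly_ring_closed
        mult.assoc)
  then show ?thesis
    using H_class_mult_idem[of "p * mvpoly_const c" n S] assms
    by (simp add: mvpoly_const_closed mvpoly_ring_closed)
qed

text \<open>Nonvanishing is detected by evaluation at \<open>S\<close>, which kills the ideal and
  sends \<open>c * idem n S\<close> to \<open>c\<close>. This is where sparseness enters.\<close>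

lemma H_class_line_eq_0_iff:
  assumes "S \<in> sparse_sets n"
  shows "H_class n (mvpoly_const (c :: 'a::field) * idem n S) = \<zero>\<^bsub>H_alg n\<^esub> \<longleftrightarrow> c = 0"
proof
  assume "H_class n (mvpoly_const c * idem n S) = \<zero>\<^bsub>H_alg n\<^esub>"
  then have "mvpoly_const c * idem n S - 0 \<in> H_ideal n"
    using H_class_eq_iff[OF const_idem_closed[OF sparse_subset[OF assms], of c] zero_closed]
    by (simp add: H_class_0)
  from indicator_eval_H_ideal[OF assms this] show "c = 0"
    by (simp add: indicator_eval_idem[OF sparse_subset sparse_subset, OF assms assms])
qed (simp add: mvpoly_const_def H_class_0)

lemma idem_line_subset: "S \<subseteq> {1..<n} \<Longrightarrow> idem_line n S \<subseteq> carrier (H_alg n)"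
  by (auto simp: idem_line_def H_class_closed const_idem_closed)

section \<open>The lines as submodules of the regular module\<close>

lemma regular_module_ops [simp]:
  "carrier (regular_module R) = carrier R" "zero (regular_module R) = zero R"
  "add (regular_module R) = add R" "module.smult (regular_module R) = monoid.mult R"
  by (simp_all add: regular_module_def)

text \<open>Both operations are built from carrier, addition and zero alone, on which the two
  records agree.\<close>

lemma regular_module_additive [simp]:
  "a_inv (regular_module R) = a_inv R" "finsum (regular_module R) = finsum R"
  by (simp_all add: fun_eq_iff a_inv_def m_inv_def finsum_def finprod_def)

lemma (in cring) regular_module: "module R (regular_module R)"
proof (rule moduleI)
  show "abelian_group (regular_module R)"
    by (rule abelian_groupI) (auto simp: a_ac intro: l_neg)
qed (auto simp: cring_axioms l_distr r_distr m_assoc)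

lemma idem_line_submodule:
  assumes "S \<subseteq> {1..<n}"
  shows "submodule (idem_line n S :: 'a::field mvpoly set set) (H_alg n) (regular_module (H_alg n))"
proof (rule module.submoduleI[OF cring.regular_module[OF H_cring]])
  show "idem_line n S \<subseteq> carrier (regular_module (H_alg n))"
    using idem_line_subset[OF assms] by simp
  have "\<zero>\<^bsub>H_alg n\<^esub> = H_class n (mvpoly_const 0 * idem n S :: 'a mvpoly)"
    by (simp add: mvpoly_const_def H_class_0)
  then show "\<zero>\<^bsub>regular_module (H_alg n)\<^esub> \<in> (idem_line n S :: 'a mvpoly set set)"
    by (simp add: idem_line_def)
next
  note closed = const_idem_closed[OF assms]
  fix a :: "'a mvpoly set" assume "a \<in> idem_line n S"
  then obtain c where a: "a = H_class n (mvpoly_const c * idem n S)" by (auto simp: idem_line_def)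
  have "- (mvpoly_const c * idem n S) = mvpoly_const (- c) * idem n S"
    by (simp add: mvpoly_const_def single_uminus)
  then show "\<ominus>\<^bsub>regular_module (H_alg n)\<^esub> a \<in> idem_line n S"
    by (auto simp: a idem_line_def H_class_uminus closed)
  fix b :: "'a mvpoly set" assume "b \<in> idem_line n S"
  then obtain d where b: "b = H_class n (mvpoly_const d * idem n S)" by (auto simp: idem_line_def)
  have "mvpoly_const c * idem n S + mvpoly_const d * idem n S = mvpoly_const (c + d) * idem n S"
    by (simp add: mvpoly_const_def single_add distrib_right)
  then show "a \<oplus>\<^bsub>regular_module (H_alg n)\<^esub> b \<in> idem_line n S"
    by (auto simp: a b idem_line_def H_class_add closed)
next
  fix a x :: "'a mvpoly set" assume "a \<in> carrier (H_alg n)" "x \<in> idem_line n S"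
  then show "a \<odot>\<^bsub>regular_module (H_alg n)\<^esub> x \<in> idem_line n S"
    using H_class_mult_line[OF _ assms] by (auto simp: carrier_H_alg idem_line_def)
qed

lemma idem_line_simple:
  assumes "S \<in> sparse_sets n"
  shows "simple_module (H_alg n :: 'a::field mvpoly set ring)
    ((regular_module (H_alg n))\<lparr>carrier := idem_line n S\<rparr>)"
    (is "simple_module ?H ?M")
  unfolding simple_module_def
proof (intro conjI allI impI)
  note sub = sparse_subset[OF assms]
  show "module ?H ?M"
    using submodule.submodule_is_module[OF idem_line_submodule[OF sub]
      cring.regular_module[OF H_cring]] .
  have "H_class n (mvpoly_const (1 :: 'a) * idem n S) \<in> idem_line n S" by (auto simp: idem_line_def)
  then show "carrier ?M \<noteq> {\<zero>\<^bsub>?M\<^esub>}"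
    using H_class_line_eq_0_iff[OF assms, where c = "1 :: 'a"] by auto
  fix N assume N: "submodule N ?H ?M"
  have N_line: "N \<subseteq> idem_line n S" and "\<zero>\<^bsub>?H\<^esub> \<in> N"
    using subgroup.subset[OF submodule.axioms(1)[OF N]]
      subgroup.one_closed[OF submodule.axioms(1)[OF N]] by simp_all
  show "N = {\<zero>\<^bsub>?M\<^esub>} \<or> N = carrier ?M"
  proof (cases "N \<subseteq> {\<zero>\<^bsub>?H\<^esub>}")
    case False
    then obtain v where v: "v \<in> N" "v \<noteq> \<zero>\<^bsub>?H\<^esub>" by blast
    then obtain c where c: "v = H_class n (mvpoly_const c * idem n S)"
      using N_line by (auto simp: idem_line_def)
    have "c \<noteq> 0" using v H_class_line_eq_0_iff[OF assms, of c] c by simp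
    have "H_class n (mvpoly_const d * idem n S) \<in> N" for d
    proof -
      \<comment> \<open>Scalars belong to the algebra, so rescaling the nonzero vector
        \<open>v\<close> reaches every point of the line.\<close>
      have "H_class n (mvpoly_const (d / c)) \<otimes>\<^bsub>?H\<^esub> v \<in> N"
        using submodule.smult_closed[OF N H_class_closed[OF mvpoly_const_closed] v(1)] by simp
      then show ?thesis
        using \<open>c \<noteq> 0\<close> by (simp add: c H_class_mult_line[OF mvpoly_const_closed sub])
    qed
    then show ?thesis using N_line by (auto simp: idem_line_def)
  qed (use \<open>\<zero>\<^bsub>?H\<^esub> \<in> N\<close> in auto)
qed

lemma idem_line_dimension:
  assumes "S \<in> sparse_sets n"
  shows "ring.dimension (H_alg n) 1 (H_scalars n) (idem_line n S :: 'a::field mvpoly set set)"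
proof -
  note sub = sparse_subset[OF assms]
  interpret H: cring "H_alg n :: 'a mvpoly set ring" by (rule H_cring)
  let ?e = "H_class n (idem n S :: 'a mvpoly)"
  have closed: "H_class n (mvpoly_const c * idem n S :: 'a mvpoly) \<in> carrier (H_alg n)" for c
    by (rule H_class_closed[OF const_idem_closed[OF sub]])
  have "?e \<noteq> \<zero>\<^bsub>H_alg n\<^esub>"
    using H_class_line_eq_0_iff[OF assms, where c = "1 :: 'a"] by (simp add: mvpoly_const_def)
  \<comment> \<open>A nonzero vector lies outside the zero space, so adjoining it raises the
    dimension from 0 to 1.\<close>
  then have "H.dimension (Suc 0) (H_scalars n) (H.line_extension (H_scalars n) ?e {\<zero>\<^bsub>H_alg n\<^esub>})"
    by (intro H.Suc_dim) (auto simp: H_class_closed idem_closed[OF sub])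
  moreover have "H.line_extension (H_scalars n) ?e {\<zero>\<^bsub>H_alg n\<^esub>} = idem_line n S"
    using closed
    by (auto simp: H.line_extension_mem_iff H_scalars_eq idem_line_def H_class_mult
        mvpoly_const_closed idem_closed[OF sub])
  ultimately show ?thesis by simp
qed

text \<open>Orthogonality: multiplication by the class of \<open>idem n T\<close> will serve as the
  projection onto the component of \<open>T\<close>.\<close>

lemma line_mult_idem:
  assumes "S \<subseteq> {1..<n}" "T \<subseteq> {1..<n}" "v \<in> idem_line n S"
  shows "v \<otimes>\<^bsub>H_alg n\<^esub> H_class n (idem n T) = (if S = T then v else \<zero>\<^bsub>H_alg n\<^esub>)"
proof -
  obtain c where "v = H_class n (mvpoly_const c * idem n S)"
    using assms(3) by (auto simp: idem_line_def)
  then show ?thesis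
    using assms by (auto simp: H_class_mult_idem const_idem_closed indicator_eval_idem)
      (simp_all add: mvpoly_const_def H_class_0)
qed

text \<open>In the polynomial ring the sum over all subsets is 1, and the terms of non-sparse sets
  lie in the ideal.\<close>

lemma finsum_idem:
  "(\<Oplus>\<^bsub>H_alg n\<^esub>S\<in>sparse_sets n. H_class n (idem n S :: 'a::field mvpoly)) = \<one>\<^bsub>H_alg n\<^esub>"
proof -
  let ?s = "\<Sum>S\<in>sparse_sets n. idem n S :: 'a mvpoly"
  let ?t = "\<Sum>S\<in>Pow {1..<n} - sparse_sets n. idem n S :: 'a mvpoly"
  have "1 = ?t + ?s"
    unfolding sum_idem[of n, symmetric]
    by (rule sum.subset_diff) (use sparse_subset in auto)
  then have "?s - 1 = - ?t" by (metis add_diff_cancel_right' minus_diff_eq)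
  moreover have "- ?t \<in> H_ideal n"
    by (intro H_ideal_uminus H_ideal_sum idem_not_sparse) auto
  moreover have "?s \<in> carrier (mvpoly_ring n)"
    by (intro sum_closed idem_closed sparse_subset)
  ultimately have "H_class n ?s = H_class n 1"
    by (simp add: H_class_eq_iff one_closed)
  then show ?thesis
    using finsum_H_class[of "sparse_sets n" "idem n :: _ \<Rightarrow> 'a mvpoly", OF idem_closed[OF sparse_subset]]
    by (simp add: H_class_1)
qed

text \<open>The inverse of the sum map multiplies \<open>h\<close> by each idempotent. Orthogonality
  recovers the components of a family, and the idempotents summing to 1 recovers \<open>h\<close>.
  The bijection \<open>D\<close> lets compositions index the lines.\<close>

lemma internal_direct_sum_idem_lines:
  assumes D: "bij_betw D A (sparse_sets n)"
  shows "internal_direct_sum (H_alg n) (regular_module (H_alg n)) A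
    (\<lambda>a :: 'b. idem_line n (D a) :: 'a::field mvpoly set set)"
proof -
  interpret H: cring "H_alg n :: 'a mvpoly set ring" by (rule H_cring)
  let ?H = "H_alg n :: 'a mvpoly set ring"
  let ?e = "\<lambda>a. H_class n (idem n (D a) :: 'a mvpoly)"
  have fin: "finite A" using D bij_betw_finite finite_sparse_sets by blast
  have sub: "D a \<subseteq> {1..<n}" if "a \<in> A" for a
    using that D sparse_subset bij_betwE by blast
  have e: "?e a \<in> carrier ?H" if "a \<in> A" for a
    using sub[OF that] by (intro H_class_closed idem_closed)
  have one: "(\<Oplus>\<^bsub>?H\<^esub>a\<in>A. ?e a) = \<one>\<^bsub>?H\<^esub>"
  proof -
    have D': "inj_on D A" "D ` A = sparse_sets n" using D by (simp_all add: bij_betw_def)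
    have "(\<lambda>S. H_class n (idem n S :: 'a mvpoly)) \<in> D ` A \<rightarrow> carrier ?H" using e by auto
    from H.add.finprod_reindex[OF this D'(1)] finsum_idem[of n, where 'a = 'a]
    show ?thesis unfolding D' by simp
  qed
  have line: "v a \<in> carrier ?H"
    if "v \<in> (\<Pi>\<^sub>E a\<in>A. idem_line n (D a))" "a \<in> A" for v a
    using that idem_line_subset[OF sub] by (auto simp: PiE_iff)
  have "bij_betw (\<lambda>v. \<Oplus>\<^bsub>?H\<^esub>a\<in>A. v a) (\<Pi>\<^sub>E a\<in>A. idem_line n (D a)) (carrier ?H)"
  \<comment> \<open>The family of projections is restricted to \<open>A\<close> because members of
    the extensional product are \<open>undefined\<close> elsewhere.\<close>
  proof (rule bij_betw_byWitness[where f' = "\<lambda>h. \<lambda>a\<in>A. h \<otimes>\<^bsub>?H\<^esub> ?e a"])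
    show "\<forall>v\<in>\<Pi>\<^sub>E a\<in>A. idem_line n (D a).
      (\<lambda>a\<in>A. (\<Oplus>\<^bsub>?H\<^esub>b\<in>A. v b) \<otimes>\<^bsub>?H\<^esub> ?e a) = v"
    proof
      fix v :: "'b \<Rightarrow> 'a mvpoly set" assume v: "v \<in> (\<Pi>\<^sub>E a\<in>A. idem_line n (D a))"
      have "(\<Oplus>\<^bsub>?H\<^esub>b\<in>A. v b) \<otimes>\<^bsub>?H\<^esub> ?e a = v a" if a: "a \<in> A" for a
      proof -
        have "(\<Oplus>\<^bsub>?H\<^esub>b\<in>A. v b) \<otimes>\<^bsub>?H\<^esub> ?e a = (\<Oplus>\<^bsub>?H\<^esub>b\<in>A. v b \<otimes>\<^bsub>?H\<^esub> ?e a)"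
          using fin e[OF a] line[OF v] by (intro H.finsum_ldistr) auto
        also have "\<dots> = (\<Oplus>\<^bsub>?H\<^esub>b\<in>A. if a = b then v b else \<zero>\<^bsub>?H\<^esub>)"
        proof (rule H.finsum_cong')
          fix b assume b: "b \<in> A"
          \<comment> \<open>Injectivity of \<open>D\<close> turns orthogonality of sets into
            orthogonality of indices.\<close>
          have "D b = D a \<longleftrightarrow> a = b" using D a b by (auto simp: bij_betw_def inj_on_def)
          then show "v b \<otimes>\<^bsub>?H\<^esub> ?e a = (if a = b then v b else \<zero>\<^bsub>?H\<^esub>)"
            using line_mult_idem[OF sub[OF b] sub[OF a], of "v b"] v b by (auto simp: PiE_iff)
        qed (use line[OF v] in auto)
        also have "\<dots> = v a"
          using fin a line[OF v] by (intro H.finsum_singleton) auto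
        finally show ?thesis .
      qed
      then show "(\<lambda>a\<in>A. (\<Oplus>\<^bsub>?H\<^esub>b\<in>A. v b) \<otimes>\<^bsub>?H\<^esub> ?e a) = v"
        using v by (intro extensionalityI[of _ A]) (auto simp: PiE_iff)
    qed
    show "\<forall>h\<in>carrier ?H. (\<Oplus>\<^bsub>?H\<^esub>b\<in>A. (\<lambda>a\<in>A. h \<otimes>\<^bsub>?H\<^esub> ?e a) b) = h"
    proof
      fix h assume h: "h \<in> carrier ?H"
      have "(\<Oplus>\<^bsub>?H\<^esub>b\<in>A. (\<lambda>a\<in>A. h \<otimes>\<^bsub>?H\<^esub> ?e a) b) = (\<Oplus>\<^bsub>?H\<^esub>b\<in>A. h \<otimes>\<^bsub>?H\<^esub> ?e b)"
        using h e by (intro H.finsum_cong') auto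
      also have "\<dots> = h \<otimes>\<^bsub>?H\<^esub> (\<Oplus>\<^bsub>?H\<^esub>b\<in>A. ?e b)"
        using fin h e by (intro H.finsum_rdistr[symmetric]) auto
      finally show "(\<Oplus>\<^bsub>?H\<^esub>b\<in>A. (\<lambda>a\<in>A. h \<otimes>\<^bsub>?H\<^esub> ?e a) b) = h"
        using h by (simp add: one)
    qed
    show "(\<lambda>v. \<Oplus>\<^bsub>?H\<^esub>a\<in>A. v a) ` (\<Pi>\<^sub>E a\<in>A. idem_line n (D a)) \<subseteq> carrier ?H"
      using line by (auto intro!: H.finsum_closed)
    show "(\<lambda>h. \<lambda>a\<in>A. h \<otimes>\<^bsub>?H\<^esub> ?e a) ` carrier ?H \<subseteq> (\<Pi>\<^sub>E a\<in>A. idem_line n (D a))"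
      using sub by (auto simp: carrier_H_alg H_class_mult_idem idem_line_def)
  qed
  then show ?thesis
    using fin idem_line_submodule[OF sub] by (auto simp: internal_direct_sum_def)
qed

theorem proposition7p4:
  fixes n :: nat
  shows "card {\<alpha>. \<alpha> \<propto> n} = fib (n + 1) \<and>
    (\<exists>C :: nat list \<Rightarrow> 'a::field mvpoly set set.
       internal_direct_sum (H_alg n) (regular_module (H_alg n)) {\<alpha>. \<alpha> \<propto> n} C \<and>
       (\<forall>\<alpha>. \<alpha> \<propto> n \<longrightarrow>
          ring.dimension (H_alg n) 1 (H_scalars n) (C \<alpha>) \<and>
          simple_module (H_alg n) ((regular_module (H_alg n))\<lparr>carrier := C \<alpha>\<rparr>) \<and>
          (\<forall>i v. 1 \<le> i \<and> i < n \<and> v \<in> C \<alpha> \<longrightarrow>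
             H_gen n i \<odot>\<^bsub>regular_module (H_alg n)\<^esub> v =
               (if i \<in> descent_set \<alpha> then v else \<zero>\<^bsub>H_alg n\<^esub>))))"
proof (intro conjI exI[of _ "\<lambda>\<alpha>. idem_line n (descent_set \<alpha>)"] allI impI)
  show "card {\<alpha>. \<alpha> \<propto> n} = fib (n + 1)"
    using bij_betw_same_card[OF bij_betw_descent_set] card_sparse_sets by simp
  show "internal_direct_sum (H_alg n) (regular_module (H_alg n)) {\<alpha>. \<alpha> \<propto> n}
      (\<lambda>\<alpha>. idem_line n (descent_set \<alpha>) :: 'a mvpoly set set)"
    by (rule internal_direct_sum_idem_lines[OF bij_betw_descent_set])
  fix \<alpha> assume "\<alpha> \<propto> n"
  then have S: "descent_set \<alpha> \<in> sparse_sets n"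
    using bij_betwE[OF bij_betw_descent_set] by blast
  show "ring.dimension (H_alg n) 1 (H_scalars n) (idem_line n (descent_set \<alpha>) :: 'a mvpoly set set)"
    by (rule idem_line_dimension[OF S])
  show "simple_module (H_alg n) ((regular_module (H_alg n :: 'a mvpoly set ring))
      \<lparr>carrier := idem_line n (descent_set \<alpha>)\<rparr>)"
    by (rule idem_line_simple[OF S])
  fix i and v :: "'a mvpoly set"
  assume iv: "1 \<le> i \<and> i < n \<and> v \<in> idem_line n (descent_set \<alpha>)"
  then obtain c where "v = H_class n (mvpoly_const c * idem n (descent_set \<alpha>))"
    by (auto simp: idem_line_def)
  \<comment> \<open>The generator acts by the value of \<open>x_i\<close> at the indicator vector of
    the descent set.\<close>
  then show "H_gen n i \<odot>\<^bsub>regular_module (H_alg n)\<^esub> v =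
      (if i \<in> descent_set \<alpha> then v else \<zero>\<^bsub>H_alg n\<^esub>)"
    using iv H_class_mult_line[OF mvpoly_var_closed sparse_subset[OF S], of i c]
    by (simp add: H_gen_eq H_class_line_eq_0_iff[OF S])
qed

end
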